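(* Let $\mathbf{A}$ be a complete BL-algebra and $\mathcal{P}=\langle W,\pi\rangle$ a possibilistic $\mathbf{A}$-frame. Then the complex $\mathbf{A}$-algebra $\langle\mathbf{A}^W,\forall^{\mathcal{P}},\exists^{\mathcal{P}}\rangle$ is an Epistemic BL-algebra, and $\pi$ is its focal element, i.e. $\pi=\min\{f\in A^W:\forall^{\mathcal{P}}f=1\}$; thus it is a c-EBL-algebra with $c=\pi$.
   Context: A BL-algebra is an algebra $\langle A,\wedge,\vee,\ast,\to,0,1\rangle$ such that $\langle A,\wedge,\vee,0,1\rangle$ is a bounded lattice (order $\le$), $\langle A,\ast,1\rangle$ is a commutative monoid, $a\ast b\le c$ iff $a\le b\to c$, and $a\wedge b=a\ast(a\to b)$ and $(a\to b)\vee(b\to a)=1$ hold; it is complete if every subset has a supremum and an infimum. An Epistemic BL-algebra is a BL-algebra with unary operations $\forall,\exists$ satisfying, for all $a,b$: $\forall 1=1$; $\exists 0=0$; $\forall a\to\exists a=1$; $\forall(a\to\forall b)=\exists a\to\forall b$; $\forall(\forall a\to b)=\forall a\to\forall b$; $\exists a\to\forall\exists a=1$; $\forall(a\wedge b)=\forall a\wedge\forall b$; $\exists(a\vee b)=\exists a\vee\exists b$; $\exists(a\ast\exists b)=\exists a\ast\exists b$. The focal element of an EBL-algebra is the least element of $\{a:\forall a=1\}$ when it exists; a c-EBL-algebra is one where it exists. A possibilistic $\mathbf{A}$-frame is a pair $\langle W,\pi\rangle$ with $W$ a non-empty set and $\pi:W\to A$ satisfying $\sup_{w\in W}\pi(w)=1$.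 $\mathbf{A}^W$ is the BL-algebra of all functions $W\to A$ with pointwise operations. For $f\in A^W$, $\forall^{\mathcal{P}}f$ is the constant function with value $\inf_{w\in W}\{\pi(w)\to f(w)\}$ and $\exists^{\mathcal{P}}f$ is the constant function with value $\sup_{w\in W}\{\pi(w)\ast f(w)\}$. *)

theory Defs
  imports "HOL-Algebra.Group"
begin

section \<open>BL-algebras\<close>

record 'a bl = "'a monoid" +
  bl_meet :: "['a, 'a] \<Rightarrow> 'a" (infixl \<open>\<curlywedge>\<index>\<close> 70)
  bl_join :: "['a, 'a] \<Rightarrow> 'a" (infixl \<open>\<curlyvee>\<index>\<close> 65)
  bl_imp :: "['a, 'a] \<Rightarrow> 'a" (infixr \<open>\<rightharpoonup>\<index>\<close> 60)
  bl_zero :: 'a (\<open>\<zero>\<index>\<close>)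

definition bl_le :: "('a, 'm) bl_scheme \<Rightarrow> 'a \<Rightarrow> 'a \<Rightarrow> bool" (infix \<open>\<preceq>\<index>\<close> 50)
  where "a \<preceq>\<^bsub>A\<^esub> b \<longleftrightarrow> a \<curlywedge>\<^bsub>A\<^esub> b = a"

definition bl_order :: "('a, 'm) bl_scheme \<Rightarrow> 'a gorder"
  where "bl_order A = \<lparr>carrier = carrier A, eq = (=), le = bl_le A\<rparr>"

locale bl_algebra = comm_monoid A for A :: "('a, 'm) bl_scheme" (structure) +
  assumes meet_closed: "\<lbrakk>a \<in> carrier A; b \<in> carrier A\<rbrakk> \<Longrightarrow> a \<curlywedge> b \<in> carrier A"
    and join_closed: "\<lbrakk>a \<in> carrier A; b \<in> carrier A\<rbrakk> \<Longrightarrow> a \<curlyvee> b \<in> carrier A"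
    and imp_closed: "\<lbrakk>a \<in> carrier A; b \<in> carrier A\<rbrakk> \<Longrightarrow> a \<rightharpoonup> b \<in> carrier A"
    and zero_closed: "\<zero> \<in> carrier A"
    and meet_assoc: "\<lbrakk>a \<in> carrier A; b \<in> carrier A; c \<in> carrier A\<rbrakk> \<Longrightarrow> (a \<curlywedge> b) \<curlywedge> c = a \<curlywedge> (b \<curlywedge> c)"
    and meet_comm: "\<lbrakk>a \<in> carrier A; b \<in> carrier A\<rbrakk> \<Longrightarrow> a \<curlywedge> b = b \<curlywedge> a"
    and join_assoc: "\<lbrakk>a \<in> carrier A; b \<in> carrier A; c \<in> carrier A\<rbrakk> \<Longrightarrow> (a \<curlyvee> b) \<curlyvee> c = a \<curlyvee> (b \<curlyvee> c)"
    and join_comm: "\<lbrakk>a \<in> carrier A; b \<in> carrier A\<rbrakk> \<Longrightarrow> a \<curlyvee> b = b \<curlyvee> a"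
    and meet_join_absorb: "\<lbrakk>a \<in> carrier A; b \<in> carrier A\<rbrakk> \<Longrightarrow> a \<curlywedge> (a \<curlyvee> b) = a"
    and join_meet_absorb: "\<lbrakk>a \<in> carrier A; b \<in> carrier A\<rbrakk> \<Longrightarrow> a \<curlyvee> (a \<curlywedge> b) = a"
    and zero_le: "a \<in> carrier A \<Longrightarrow> \<zero> \<preceq> a"
    and le_one: "a \<in> carrier A \<Longrightarrow> a \<preceq> \<one>"
    and residuation: "\<lbrakk>a \<in> carrier A; b \<in> carrier A; c \<in> carrier A\<rbrakk> \<Longrightarrow> a \<otimes> b \<preceq> c \<longleftrightarrow> a \<preceq> b \<rightharpoonup> c"
    and divisibility: "\<lbrakk>a \<in> carrier A; b \<in> carrier A\<rbrakk> \<Longrightarrow> a \<curlywedge> b = a \<otimes> (a \<rightharpoonup> b)"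
    and prelinearity: "\<lbrakk>a \<in> carrier A; b \<in> carrier A\<rbrakk> \<Longrightarrow> (a \<rightharpoonup> b) \<curlyvee> (b \<rightharpoonup> a) = \<one>"

locale complete_bl_algebra = bl_algebra +
  assumes complete: "complete_lattice (bl_order A)"


section \<open>Epistemic BL-algebras\<close>

record 'a ebl = "'a bl" +
  ebl_all :: "'a \<Rightarrow> 'a" (\<open>\<^bold>\<forall>\<index> _\<close> [81] 80)
  ebl_ex :: "'a \<Rightarrow> 'a" (\<open>\<^bold>\<exists>\<index> _\<close> [81] 80)

locale epistemic_bl_algebra = bl_algebra E for E :: "('a, 'm) ebl_scheme" (structure) +
  assumes all_closed: "a \<in> carrier E \<Longrightarrow> \<^bold>\<forall> a \<in> carrier E"
    and ex_closed: "a \<in> carrier E \<Longrightarrow> \<^bold>\<exists> a \<in> carrier E"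
    and all_one: "\<^bold>\<forall> \<one> = \<one>"
    and ex_zero: "\<^bold>\<exists> \<zero> = \<zero>"
    and all_imp_ex: "a \<in> carrier E \<Longrightarrow> (\<^bold>\<forall> a) \<rightharpoonup> (\<^bold>\<exists> a) = \<one>"
    and all_imp_all: "\<lbrakk>a \<in> carrier E; b \<in> carrier E\<rbrakk> \<Longrightarrow> \<^bold>\<forall> (a \<rightharpoonup> (\<^bold>\<forall> b)) = (\<^bold>\<exists> a) \<rightharpoonup> (\<^bold>\<forall> b)"
    and all_all_imp: "\<lbrakk>a \<in> carrier E; b \<in> carrier E\<rbrakk> \<Longrightarrow> \<^bold>\<forall> ((\<^bold>\<forall> a) \<rightharpoonup> b) = (\<^bold>\<forall> a) \<rightharpoonup> (\<^bold>\<forall> b)"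
    and ex_imp_all_ex: "a \<in> carrier E \<Longrightarrow> (\<^bold>\<exists> a) \<rightharpoonup> (\<^bold>\<forall> (\<^bold>\<exists> a)) = \<one>"
    and all_meet: "\<lbrakk>a \<in> carrier E; b \<in> carrier E\<rbrakk> \<Longrightarrow> \<^bold>\<forall> (a \<curlywedge> b) = (\<^bold>\<forall> a) \<curlywedge> (\<^bold>\<forall> b)"
    and ex_join: "\<lbrakk>a \<in> carrier E; b \<in> carrier E\<rbrakk> \<Longrightarrow> \<^bold>\<exists> (a \<curlyvee> b) = (\<^bold>\<exists> a) \<curlyvee> (\<^bold>\<exists> b)"
    and ex_mult_ex: "\<lbrakk>a \<in> carrier E; b \<in> carrier E\<rbrakk> \<Longrightarrow> \<^bold>\<exists> (a \<otimes> (\<^bold>\<exists> b)) = (\<^bold>\<exists> a) \<otimes> (\<^bold>\<exists> b)"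

definition focal_element :: "('a, 'm) ebl_scheme \<Rightarrow> 'a \<Rightarrow> bool"
  where "focal_element E c \<longleftrightarrow> least (bl_order E) c {a \<in> carrier E. \<^bold>\<forall>\<^bsub>E\<^esub> a = \<one>\<^bsub>E\<^esub>}"

locale c_ebl_algebra = epistemic_bl_algebra +
  assumes focal_exists: "\<exists>c. focal_element E c"


section \<open>Possibilistic frames and their complex algebras\<close>

text \<open>Maps from \<open>W\<close> to \<open>A\<close> are represented by the extensional functions
  \<open>W \<rightarrow>\<^sub>E carrier A\<close>, so that equality in \<open>A\<^sup>W\<close> is HOL equality.\<close>

definition possibilistic_frame :: "('a, 'm) bl_scheme \<Rightarrow> 'w set \<Rightarrow> ('w \<Rightarrow> 'a) \<Rightarrow> bool"
  where "possibilistic_frame A W \<pi> \<longleftrightarrow>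
    W \<noteq> {} \<and> \<pi> \<in> W \<rightarrow>\<^sub>E carrier A \<and> \<Squnion>\<^bsub>bl_order A\<^esub> {\<pi> w | w. w \<in> W} = \<one>\<^bsub>A\<^esub>"

definition complex_algebra ::
    "('a, 'm) bl_scheme \<Rightarrow> 'w set \<Rightarrow> ('w \<Rightarrow> 'a) \<Rightarrow> ('w \<Rightarrow> 'a) ebl"
  where "complex_algebra A W \<pi> =
    \<lparr>carrier = W \<rightarrow>\<^sub>E carrier A,
     mult = (\<lambda>f g. \<lambda>w\<in>W. f w \<otimes>\<^bsub>A\<^esub> g w),
     one = (\<lambda>w\<in>W. \<one>\<^bsub>A\<^esub>),
     bl_meet = (\<lambda>f g. \<lambda>w\<in>W. f w \<curlywedge>\<^bsub>A\<^esub> g w),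
     bl_join = (\<lambda>f g. \<lambda>w\<in>W. f w \<curlyvee>\<^bsub>A\<^esub> g w),
     bl_imp = (\<lambda>f g. \<lambda>w\<in>W. f w \<rightharpoonup>\<^bsub>A\<^esub> g w),
     bl_zero = (\<lambda>w\<in>W. \<zero>\<^bsub>A\<^esub>),
     ebl_all = (\<lambda>f. \<lambda>v\<in>W. \<Sqinter>\<^bsub>bl_order A\<^esub> {\<pi> w \<rightharpoonup>\<^bsub>A\<^esub> f w | w. w \<in> W}),
     ebl_ex = (\<lambda>f. \<lambda>v\<in>W. \<Squnion>\<^bsub>bl_order A\<^esub> {\<pi> w \<otimes>\<^bsub>A\<^esub> f w | w. w \<in> W})\<rparr>"

end

theory Submission
  imports Defs
begin

text \<open>By residuation, \<open>c \<le> \<forall>f\<close> iff \<open>c * \<pi> w \<le> f w\<close> for all \<open>w\<close>, and \<open>\<exists>f \<le> c\<close> iff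
  \<open>\<pi> w * f w \<le> c\<close> for all \<open>w\<close>. For an arbitrary \<open>\<pi>\<close> these two equivalences give every axiom except
  \<open>\<forall>f \<le> \<exists>f\<close>, as well as the minimality of \<open>\<pi>\<close>. The remaining axiom is where \<open>sup \<pi> = 1\<close> and
  prelinearity enter: prelinearity gives \<open>x * y \<le> x\<^sup>2 \<or> y\<^sup>2\<close>, hence \<open>sup \<pi>\<^sup>2 = (sup \<pi>)\<^sup>2 = 1\<close>, while
  \<open>\<pi>\<^sup>2 * \<forall>f \<le> \<pi> * f \<le> \<exists>f\<close> pointwise.\<close>

lemma (in partial_order) eqI_lower_bounds:
  assumes "x \<in> carrier L" "y \<in> carrier L" "\<And>z. z \<in> carrier L \<Longrightarrow> z \<sqsubseteq> x \<longleftrightarrow> z \<sqsubseteq> y"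
  shows "x = y"
  using assms le_antisym le_refl by blast

lemma (in partial_order) eqI_upper_bounds:
  assumes "x \<in> carrier L" "y \<in> carrier L" "\<And>z. z \<in> carrier L \<Longrightarrow> x \<sqsubseteq> z \<longleftrightarrow> y \<sqsubseteq> z"
  shows "x = y"
  using assms le_antisym le_refl by blast

lemma (in weak_complete_lattice) le_inf_iff:
  assumes "S \<subseteq> carrier L" "x \<in> carrier L"
  shows "x \<sqsubseteq> \<Sqinter> S \<longleftrightarrow> (\<forall>s\<in>S. x \<sqsubseteq> s)"
proof
  show "\<forall>s\<in>S. x \<sqsubseteq> s" if "x \<sqsubseteq> \<Sqinter> S"
    using that assms by (meson inf_closed inf_lower le_trans subsetD)
  show "x \<sqsubseteq> \<Sqinter> S" if "\<forall>s\<in>S. x \<sqsubseteq> s"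
    using that assms by (intro inf_greatest) (auto simp: Lower_def)
qed

lemma (in weak_complete_lattice) sup_le_iff:
  assumes "S \<subseteq> carrier L" "x \<in> carrier L"
  shows "\<Squnion> S \<sqsubseteq> x \<longleftrightarrow> (\<forall>s\<in>S. s \<sqsubseteq> x)"
proof
  show "\<forall>s\<in>S. s \<sqsubseteq> x" if "\<Squnion> S \<sqsubseteq> x"
    using that assms by (meson sup_closed sup_upper le_trans subsetD)
  show "\<Squnion> S \<sqsubseteq> x" if "\<forall>s\<in>S. s \<sqsubseteq> x"
    using that assms by (intro sup_least) (auto simp: Upper_def)
qed

lemma restrict_eq_iff:
  "f \<in> A \<rightarrow>\<^sub>E B \<Longrightarrow> restrict g A = f \<longleftrightarrow> (\<forall>x\<in>A. g x = f x)"
  by (auto simp: fun_eq_iff restrict_def PiE_def extensional_def)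


section \<open>BL-algebras\<close>

context bl_algebra
begin

declare meet_closed [simp] join_closed [simp] imp_closed [simp] zero_closed [simp]

lemma partial_order_bl_order: "partial_order (bl_order A)"
proof -
  have refl: "a \<preceq> a" if "a \<in> carrier A" for a
    using that unfolding bl_le_def by (metis join_closed join_meet_absorb meet_join_absorb)
  have antisym: "a = b" if "a \<preceq> b" "b \<preceq> a" "a \<in> carrier A" "b \<in> carrier A" for a b
    using that unfolding bl_le_def by (metis meet_comm)
  have trans: "a \<preceq> c"
    if "a \<preceq> b" "b \<preceq> c" "a \<in> carrier A" "b \<in> carrier A" "c \<in> carrier A" for a b c
    using that unfolding bl_le_def by (metis meet_assoc)
  show ?thesis
    by unfold_locales (simp_all add: bl_order_def refl antisym, blast intro: trans)
qed

end

sublocale bl_algebra \<subseteq> order: partial_order "bl_order A"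
  rewrites "carrier (bl_order A) = carrier A" and "le (bl_order A) = bl_le A"
  by (fact partial_order_bl_order) (simp_all add: bl_order_def)

context bl_algebra
begin

lemma le_meet_iff:
  assumes "a \<in> carrier A" "b \<in> carrier A" "c \<in> carrier A"
  shows "c \<preceq> a \<curlywedge> b \<longleftrightarrow> c \<preceq> a \<and> c \<preceq> b"
proof
  have "a \<curlywedge> b \<preceq> a" "a \<curlywedge> b \<preceq> b"
    using assms order.le_refl unfolding bl_le_def by (metis meet_assoc meet_comm)+
  then show "c \<preceq> a \<and> c \<preceq> b" if "c \<preceq> a \<curlywedge> b"
    using that assms order.le_trans meet_closed by blast
  show "c \<preceq> a \<curlywedge> b" if "c \<preceq> a \<and> c \<preceq> b"
    using that assms unfolding bl_le_def by (metis meet_assoc)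
qed

lemma le_iff_join: "\<lbrakk>a \<in> carrier A; b \<in> carrier A\<rbrakk> \<Longrightarrow> a \<preceq> b \<longleftrightarrow> a \<curlyvee> b = b"
  unfolding bl_le_def by (metis join_comm join_meet_absorb meet_comm meet_join_absorb)

lemma join_le_iff:
  assumes "a \<in> carrier A" "b \<in> carrier A" "c \<in> carrier A"
  shows "a \<curlyvee> b \<preceq> c \<longleftrightarrow> a \<preceq> c \<and> b \<preceq> c"
proof
  have "a \<preceq> a \<curlyvee> b" "b \<preceq> a \<curlyvee> b"
    using assms unfolding bl_le_def by (metis join_comm meet_join_absorb)+
  then show "a \<preceq> c \<and> b \<preceq> c" if "a \<curlyvee> b \<preceq> c"
    using that assms order.le_trans join_closed by blast
  show "a \<curlyvee> b \<preceq> c" if "a \<preceq> c \<and> b \<preceq> c"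
    using that assms by (metis le_iff_join join_assoc join_closed)
qed

lemma one_le_iff: "a \<in> carrier A \<Longrightarrow> \<one> \<preceq> a \<longleftrightarrow> a = \<one>"
  using le_one order.le_antisym order.le_refl by blast

lemma residuation_left:
  "\<lbrakk>a \<in> carrier A; b \<in> carrier A; c \<in> carrier A\<rbrakk> \<Longrightarrow> a \<otimes> b \<preceq> c \<longleftrightarrow> b \<preceq> a \<rightharpoonup> c"
  using residuation[of b a c] m_comm[of a b] by simp

lemma imp_eq_one_iff:
  "\<lbrakk>a \<in> carrier A; b \<in> carrier A\<rbrakk> \<Longrightarrow> a \<rightharpoonup> b = \<one> \<longleftrightarrow> a \<preceq> b"
  using residuation[of \<one> a b] one_le_iff[of "a \<rightharpoonup> b"] by simp

lemma mult_imp_le: "\<lbrakk>a \<in> carrier A; b \<in> carrier A\<rbrakk> \<Longrightarrow> a \<otimes> (a \<rightharpoonup> b) \<preceq> b"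
  by (simp add: residuation_left)

lemma mult_right_mono:
  assumes "a \<preceq> b" "a \<in> carrier A" "b \<in> carrier A" "c \<in> carrier A"
  shows "a \<otimes> c \<preceq> b \<otimes> c"
proof -
  have "b \<preceq> c \<rightharpoonup> b \<otimes> c"
    using assms by (simp flip: residuation)
  then have "a \<preceq> c \<rightharpoonup> b \<otimes> c"
    using assms order.le_trans[of a b] by simp
  then show ?thesis
    using assms by (simp add: residuation)
qed

lemma mult_mono:
  assumes "a \<preceq> b" "c \<preceq> d"
    and "a \<in> carrier A" "b \<in> carrier A" "c \<in> carrier A" "d \<in> carrier A"
  shows "a \<otimes> c \<preceq> b \<otimes> d"
proof (rule order.le_trans)
  show "a \<otimes> c \<preceq> b \<otimes> c"
    using assms by (simp add: mult_right_mono)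
  show "b \<otimes> c \<preceq> b \<otimes> d"
    using assms by (simp add: mult_right_mono m_comm[of b])
qed (use assms in simp_all)

lemma mult_le_left: "\<lbrakk>a \<in> carrier A; b \<in> carrier A\<rbrakk> \<Longrightarrow> a \<otimes> b \<preceq> a"
  using mult_mono[of a a b \<one>] by (simp add: le_one)

lemma imp_le_mult_imp_mult:
  assumes "a \<in> carrier A" "b \<in> carrier A" "c \<in> carrier A"
  shows "a \<rightharpoonup> b \<preceq> a \<otimes> c \<rightharpoonup> b \<otimes> c"
proof -
  have "a \<otimes> (a \<rightharpoonup> b) \<otimes> c \<preceq> b \<otimes> c"
    using assms by (intro mult_right_mono mult_imp_le) simp_all
  then show ?thesis
    using assms by (simp add: m_ac flip: residuation)
qed

lemma imp_right_mono:
  assumes "b \<preceq> c" "a \<in> carrier A" "b \<in> carrier A" "c \<in> carrier A"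
  shows "a \<rightharpoonup> b \<preceq> a \<rightharpoonup> c"
  using assms order.le_trans[OF mult_imp_le[of a b] assms(1)] by (simp flip: residuation_left)

lemma mult_le_join_squares:
  assumes "a \<in> carrier A" "b \<in> carrier A"
  shows "a \<otimes> b \<preceq> a \<otimes> a \<curlyvee> b \<otimes> b" (is "_ \<preceq> ?s")
proof -
  have squares_le: "a \<otimes> a \<preceq> ?s" "b \<otimes> b \<preceq> ?s"
    using assms join_le_iff[of "a \<otimes> a" "b \<otimes> b" ?s] by simp_all
  have "a \<rightharpoonup> b \<preceq> a \<otimes> b \<rightharpoonup> b \<otimes> b" "b \<rightharpoonup> a \<preceq> a \<otimes> b \<rightharpoonup> a \<otimes> a"
    using assms imp_le_mult_imp_mult[of a b b] imp_le_mult_imp_mult[of b a a]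
    by (simp_all add: m_comm)
  moreover have "a \<otimes> b \<rightharpoonup> b \<otimes> b \<preceq> a \<otimes> b \<rightharpoonup> ?s" "a \<otimes> b \<rightharpoonup> a \<otimes> a \<preceq> a \<otimes> b \<rightharpoonup> ?s"
    using assms squares_le by (simp_all add: imp_right_mono)
  ultimately have "a \<rightharpoonup> b \<preceq> a \<otimes> b \<rightharpoonup> ?s" "b \<rightharpoonup> a \<preceq> a \<otimes> b \<rightharpoonup> ?s"
    using assms by (meson imp_closed join_closed m_closed order.le_trans)+
  then have "(a \<rightharpoonup> b) \<curlyvee> (b \<rightharpoonup> a) \<preceq> a \<otimes> b \<rightharpoonup> ?s"
    using assms by (simp add: join_le_iff)
  then show ?thesis
    using assms by (simp add: prelinearity one_le_iff imp_eq_one_iff)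
qed

end

sublocale complete_bl_algebra \<subseteq> order: complete_lattice "bl_order A"
  rewrites "carrier (bl_order A) = carrier A" and "le (bl_order A) = bl_le A"
  by (fact complete) (simp_all add: bl_order_def)

context complete_bl_algebra
begin

lemma sup_mult_le_iff:
  assumes "S \<subseteq> carrier A" "b \<in> carrier A" "c \<in> carrier A"
  shows "(\<Squnion>\<^bsub>bl_order A\<^esub> S) \<otimes> b \<preceq> c \<longleftrightarrow> (\<forall>s\<in>S. s \<otimes> b \<preceq> c)"
  using assms by (auto simp: residuation order.sup_le_iff subset_iff)

lemma sup_square_le_iff:
  assumes S_closed: "S \<subseteq> carrier A" and c_closed: "c \<in> carrier A"
  shows "(\<Squnion>\<^bsub>bl_order A\<^esub> S) \<otimes> (\<Squnion>\<^bsub>bl_order A\<^esub> S) \<preceq> c \<longleftrightarrow> (\<forall>s\<in>S. s \<otimes> s \<preceq> c)"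
proof -
  let ?s = "\<Squnion>\<^bsub>bl_order A\<^esub> S"
  have sup_closed: "?s \<in> carrier A"
    using S_closed by (rule order.sup_closed)
  have "?s \<otimes> ?s \<preceq> c \<longleftrightarrow> (\<forall>s\<in>S. s \<otimes> ?s \<preceq> c)"
    using S_closed sup_closed c_closed by (rule sup_mult_le_iff)
  also have "\<dots> \<longleftrightarrow> (\<forall>s\<in>S. ?s \<otimes> s \<preceq> c)"
    using S_closed sup_closed by (simp add: m_comm subset_iff)
  also have "\<dots> \<longleftrightarrow> (\<forall>s\<in>S. \<forall>t\<in>S. t \<otimes> s \<preceq> c)"
    using S_closed c_closed by (simp add: sup_mult_le_iff subset_iff)
  also have "\<dots> \<longleftrightarrow> (\<forall>s\<in>S. s \<otimes> s \<preceq> c)"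
  proof (intro iffI ballI)
    fix s t assume squares_le: "\<forall>s\<in>S. s \<otimes> s \<preceq> c" and in_S: "s \<in> S" "t \<in> S"
    then have "t \<otimes> t \<curlyvee> s \<otimes> s \<preceq> c"
      using S_closed c_closed by (subst join_le_iff) auto
    then show "t \<otimes> s \<preceq> c"
      using S_closed c_closed in_S order.le_trans[OF mult_le_join_squares[of t s]] by (simp add: subset_iff)
  qed blast
  finally show ?thesis .
qed

end


section \<open>The BL-algebra of functions\<close>

lemma complex_algebra_simps [simp]:
  "carrier (complex_algebra A W \<pi>) = (W \<rightarrow>\<^sub>E carrier A)"
  "f \<otimes>\<^bsub>complex_algebra A W \<pi>\<^esub> g = (\<lambda>w\<in>W. f w \<otimes>\<^bsub>A\<^esub> g w)"
  "\<one>\<^bsub>complex_algebra A W \<pi>\<^esub> = (\<lambda>w\<in>W. \<one>\<^bsub>A\<^esub>)"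
  "f \<curlywedge>\<^bsub>complex_algebra A W \<pi>\<^esub> g = (\<lambda>w\<in>W. f w \<curlywedge>\<^bsub>A\<^esub> g w)"
  "f \<curlyvee>\<^bsub>complex_algebra A W \<pi>\<^esub> g = (\<lambda>w\<in>W. f w \<curlyvee>\<^bsub>A\<^esub> g w)"
  "f \<rightharpoonup>\<^bsub>complex_algebra A W \<pi>\<^esub> g = (\<lambda>w\<in>W. f w \<rightharpoonup>\<^bsub>A\<^esub> g w)"
  "\<zero>\<^bsub>complex_algebra A W \<pi>\<^esub> = (\<lambda>w\<in>W. \<zero>\<^bsub>A\<^esub>)"
  by (simp_all add: complex_algebra_def)

lemma complex_algebra_le_iff:
  "f \<in> W \<rightarrow>\<^sub>E carrier A \<Longrightarrow> f \<preceq>\<^bsub>complex_algebra A W \<pi>\<^esub> g \<longleftrightarrow> (\<forall>w\<in>W. f w \<preceq>\<^bsub>A\<^esub> g w)"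
  by (simp add: bl_le_def restrict_eq_iff)

lemma (in bl_algebra) bl_algebra_complex_algebra: "bl_algebra (complex_algebra A W \<pi>)"
proof (rule bl_algebra.intro)
  have mem: "f w \<in> carrier A" if "f \<in> W \<rightarrow>\<^sub>E carrier A" "w \<in> W" for f w
    using that by (rule PiE_mem)
  show "comm_monoid (complex_algebra A W \<pi>)"
    by unfold_locales (auto simp: restrict_eq_iff mem m_ac intro!: restrict_ext)
  show "bl_algebra_axioms (complex_algebra A W \<pi>)"
    by unfold_locales
      (auto simp: complex_algebra_le_iff restrict_eq_iff mem meet_assoc join_assoc
        meet_join_absorb join_meet_absorb zero_le le_one residuation prelinearity
        intro!: restrict_ext meet_comm join_comm divisibility)
qed


section \<open>Necessity and possibility\<close>

locale possibility_distribution = complete_bl_algebra +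
  fixes W :: "'w set" and \<pi> :: "'w \<Rightarrow> 'a"
  assumes distribution: "\<pi> \<in> W \<rightarrow>\<^sub>E carrier A"
begin

definition necessity :: "('w \<Rightarrow> 'a) \<Rightarrow> 'a"
  where "necessity f = \<Sqinter>\<^bsub>bl_order A\<^esub> {\<pi> w \<rightharpoonup> f w | w. w \<in> W}"

definition possibility :: "('w \<Rightarrow> 'a) \<Rightarrow> 'a"
  where "possibility f = \<Squnion>\<^bsub>bl_order A\<^esub> {\<pi> w \<otimes> f w | w. w \<in> W}"

lemma distribution_closed [simp]: "w \<in> W \<Longrightarrow> \<pi> w \<in> carrier A"
  using distribution by (rule PiE_mem)

lemma necessity_cong: "(\<And>w. w \<in> W \<Longrightarrow> f w = g w) \<Longrightarrow> necessity f = necessity g"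
  unfolding necessity_def by (metis (lifting))

lemma possibility_cong: "(\<And>w. w \<in> W \<Longrightarrow> f w = g w) \<Longrightarrow> possibility f = possibility g"
  unfolding possibility_def by (metis (lifting))

lemma necessity_closed [simp]: "f \<in> W \<rightarrow> carrier A \<Longrightarrow> necessity f \<in> carrier A"
  unfolding necessity_def by (rule order.inf_closed) (auto simp: Pi_iff)

lemma possibility_closed [simp]: "f \<in> W \<rightarrow> carrier A \<Longrightarrow> possibility f \<in> carrier A"
  unfolding possibility_def by (rule order.sup_closed) (auto simp: Pi_iff)

lemma le_necessity_iff:
  assumes "f \<in> W \<rightarrow> carrier A" "c \<in> carrier A"
  shows "c \<preceq> necessity f \<longleftrightarrow> (\<forall>w\<in>W. c \<otimes> \<pi> w \<preceq> f w)"
proof -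
  have "c \<preceq> necessity f \<longleftrightarrow> (\<forall>w\<in>W. c \<preceq> \<pi> w \<rightharpoonup> f w)"
    unfolding necessity_def using assms by (subst order.le_inf_iff) (auto simp: Pi_iff)
  then show ?thesis
    using assms by (simp add: residuation Pi_iff)
qed

lemma possibility_le_iff:
  assumes "f \<in> W \<rightarrow> carrier A" "c \<in> carrier A"
  shows "possibility f \<preceq> c \<longleftrightarrow> (\<forall>w\<in>W. \<pi> w \<otimes> f w \<preceq> c)"
  unfolding possibility_def using assms by (subst order.sup_le_iff) (auto simp: Pi_iff)

lemma necessity_mult_le:
  "\<lbrakk>f \<in> W \<rightarrow> carrier A; w \<in> W\<rbrakk> \<Longrightarrow> necessity f \<otimes> \<pi> w \<preceq> f w"
  using le_necessity_iff[of f "necessity f"] by simp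

lemma mult_le_possibility:
  "\<lbrakk>f \<in> W \<rightarrow> carrier A; w \<in> W\<rbrakk> \<Longrightarrow> \<pi> w \<otimes> f w \<preceq> possibility f"
  using possibility_le_iff[of f "possibility f"] by simp

lemma le_necessity_const: "k \<in> carrier A \<Longrightarrow> k \<preceq> necessity (\<lambda>w. k)"
  by (simp add: le_necessity_iff mult_le_left)

lemma possibility_zero: "possibility (\<lambda>w. \<zero>) = \<zero>"
  by (rule order.le_antisym) (simp_all add: possibility_le_iff residuation_left zero_le)

lemma necessity_eq_one_iff:
  "f \<in> W \<rightarrow> carrier A \<Longrightarrow> necessity f = \<one> \<longleftrightarrow> (\<forall>w\<in>W. \<pi> w \<preceq> f w)"
  by (simp add: le_necessity_iff flip: one_le_iff)

lemma necessity_imp_const: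
  assumes "f \<in> W \<rightarrow> carrier A" and "k \<in> carrier A"
  shows "necessity (\<lambda>w. f w \<rightharpoonup> k) = possibility f \<rightharpoonup> k"
proof (rule order.eqI_lower_bounds)
  fix c assume c_closed: "c \<in> carrier A"
  have "c \<preceq> necessity (\<lambda>w. f w \<rightharpoonup> k) \<longleftrightarrow> (\<forall>w\<in>W. \<pi> w \<otimes> f w \<preceq> c \<rightharpoonup> k)"
    using assms c_closed by (simp add: le_necessity_iff Pi_iff m_ac flip: residuation)
  also have "\<dots> \<longleftrightarrow> possibility f \<preceq> c \<rightharpoonup> k"
    using assms c_closed by (simp add: possibility_le_iff)
  also have "\<dots> \<longleftrightarrow> c \<preceq> possibility f \<rightharpoonup> k"
    using assms c_closed by (simp add: m_comm flip: residuation)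
  finally show "c \<preceq> necessity (\<lambda>w. f w \<rightharpoonup> k) \<longleftrightarrow> c \<preceq> possibility f \<rightharpoonup> k" .
qed (use assms in \<open>simp_all add: Pi_iff\<close>)

lemma necessity_const_imp:
  assumes "f \<in> W \<rightarrow> carrier A" and "k \<in> carrier A"
  shows "necessity (\<lambda>w. k \<rightharpoonup> f w) = k \<rightharpoonup> necessity f"
proof (rule order.eqI_lower_bounds)
  fix c assume c_closed: "c \<in> carrier A"
  have "c \<preceq> necessity (\<lambda>w. k \<rightharpoonup> f w) \<longleftrightarrow> (\<forall>w\<in>W. (c \<otimes> k) \<otimes> \<pi> w \<preceq> f w)"
    using assms c_closed by (simp add: le_necessity_iff Pi_iff m_ac flip: residuation)
  also have "\<dots> \<longleftrightarrow> c \<preceq> k \<rightharpoonup> necessity f"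
    using assms c_closed by (simp add: le_necessity_iff flip: residuation)
  finally show "c \<preceq> necessity (\<lambda>w. k \<rightharpoonup> f w) \<longleftrightarrow> c \<preceq> k \<rightharpoonup> necessity f" .
qed (use assms in \<open>simp_all add: Pi_iff\<close>)

lemma necessity_meet:
  assumes "f \<in> W \<rightarrow> carrier A" and "g \<in> W \<rightarrow> carrier A"
  shows "necessity (\<lambda>w. f w \<curlywedge> g w) = necessity f \<curlywedge> necessity g"
proof (rule order.eqI_lower_bounds)
  fix c assume c_closed: "c \<in> carrier A"
  show "c \<preceq> necessity (\<lambda>w. f w \<curlywedge> g w) \<longleftrightarrow> c \<preceq> necessity f \<curlywedge> necessity g"
    using assms c_closed by (auto simp: le_necessity_iff le_meet_iff Pi_iff)
qed (use assms in \<open>simp_all add: Pi_iff\<close>)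

lemma possibility_join:
  assumes "f \<in> W \<rightarrow> carrier A" and "g \<in> W \<rightarrow> carrier A"
  shows "possibility (\<lambda>w. f w \<curlyvee> g w) = possibility f \<curlyvee> possibility g"
proof (rule order.eqI_upper_bounds)
  fix c assume c_closed: "c \<in> carrier A"
  show "possibility (\<lambda>w. f w \<curlyvee> g w) \<preceq> c \<longleftrightarrow> possibility f \<curlyvee> possibility g \<preceq> c"
    using assms c_closed by (auto simp: possibility_le_iff join_le_iff residuation_left Pi_iff)
qed (use assms in \<open>simp_all add: Pi_iff\<close>)

lemma possibility_mult_const:
  assumes "f \<in> W \<rightarrow> carrier A" and "k \<in> carrier A"
  shows "possibility (\<lambda>w. f w \<otimes> k) = possibility f \<otimes> k"
proof (rule order.eqI_upper_bounds)
  fix c assume c_closed: "c \<in> carrier A"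
  have "possibility (\<lambda>w. f w \<otimes> k) \<preceq> c \<longleftrightarrow> (\<forall>w\<in>W. \<pi> w \<otimes> f w \<preceq> k \<rightharpoonup> c)"
    using assms c_closed by (simp add: possibility_le_iff Pi_iff m_assoc flip: residuation)
  also have "\<dots> \<longleftrightarrow> possibility f \<otimes> k \<preceq> c"
    using assms c_closed by (simp add: possibility_le_iff residuation)
  finally show "possibility (\<lambda>w. f w \<otimes> k) \<preceq> c \<longleftrightarrow> possibility f \<otimes> k \<preceq> c" .
qed (use assms in \<open>simp_all add: Pi_iff\<close>)

lemma sup_square_le_necessity_imp_possibility:
  assumes f_closed: "f \<in> W \<rightarrow> carrier A"
  defines "s \<equiv> \<Squnion>\<^bsub>bl_order A\<^esub> {\<pi> w | w. w \<in> W}"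
  shows "s \<otimes> s \<preceq> necessity f \<rightharpoonup> possibility f"
proof -
  have "\<pi> w \<otimes> \<pi> w \<preceq> necessity f \<rightharpoonup> possibility f" if w_in_W: "w \<in> W" for w
  proof -
    have "necessity f \<otimes> \<pi> w \<otimes> \<pi> w \<preceq> f w \<otimes> \<pi> w"
      using f_closed w_in_W by (intro mult_right_mono necessity_mult_le) (simp_all add: Pi_iff)
    moreover have "f w \<otimes> \<pi> w \<preceq> possibility f"
      using f_closed w_in_W mult_le_possibility[of f w] by (simp add: m_comm Pi_iff)
    ultimately have "necessity f \<otimes> \<pi> w \<otimes> \<pi> w \<preceq> possibility f"
      by (rule order.le_trans) (use f_closed w_in_W in \<open>simp_all add: Pi_iff\<close>)
    then show ?thesis
      using f_closed w_in_W by (simp add: m_assoc flip: residuation_left)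
  qed
  moreover have "{\<pi> w | w. w \<in> W} \<subseteq> carrier A"
    by auto
  ultimately show ?thesis
    unfolding s_def using f_closed by (subst sup_square_le_iff) auto
qed

lemma necessity_le_possibility:
  assumes "\<Squnion>\<^bsub>bl_order A\<^esub> {\<pi> w | w. w \<in> W} = \<one>" and f_closed: "f \<in> W \<rightarrow> carrier A"
  shows "necessity f \<preceq> possibility f"
  using sup_square_le_necessity_imp_possibility[OF f_closed] assms
  by (simp add: one_le_iff imp_eq_one_iff)


section \<open>The complex algebra\<close>

lemma all_complex_algebra: "\<^bold>\<forall>\<^bsub>complex_algebra A W \<pi>\<^esub> f = (\<lambda>v\<in>W. necessity f)"
  by (simp add: complex_algebra_def necessity_def)

lemma ex_complex_algebra: "\<^bold>\<exists>\<^bsub>complex_algebra A W \<pi>\<^esub> f = (\<lambda>v\<in>W. possibility f)"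
  by (simp add: complex_algebra_def possibility_def)

lemma all_complex_algebra_eq_one_iff:
  assumes "f \<in> W \<rightarrow>\<^sub>E carrier A"
  shows "\<^bold>\<forall>\<^bsub>complex_algebra A W \<pi>\<^esub> f = (\<lambda>w\<in>W. \<one>) \<longleftrightarrow> (\<forall>w\<in>W. \<pi> w \<preceq> f w)"
proof -
  have "\<^bold>\<forall>\<^bsub>complex_algebra A W \<pi>\<^esub> f = (\<lambda>w\<in>W. \<one>) \<longleftrightarrow> (\<forall>w\<in>W. necessity f = \<one>)"
    by (simp add: all_complex_algebra restrict_eq_iff[where B = "carrier A"])
  moreover have "f \<in> W \<rightarrow> carrier A"
    using assms by auto
  ultimately show ?thesis
    by (auto simp: necessity_eq_one_iff)
qed

lemma epistemic_bl_algebra_complex_algebra: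
  assumes normal: "\<Squnion>\<^bsub>bl_order A\<^esub> {\<pi> w | w. w \<in> W} = \<one>"
  shows "epistemic_bl_algebra (complex_algebra A W \<pi>)" (is "epistemic_bl_algebra ?E")
proof (intro epistemic_bl_algebra.intro bl_algebra_complex_algebra epistemic_bl_algebra_axioms.intro)
  note quantifiers = all_complex_algebra ex_complex_algebra
  fix f assume "f \<in> carrier ?E"
  then have f_closed: "f \<in> W \<rightarrow> carrier A"
    by auto
  show "\<^bold>\<forall>\<^bsub>?E\<^esub> f \<in> carrier ?E" "\<^bold>\<exists>\<^bsub>?E\<^esub> f \<in> carrier ?E"
    using f_closed by (simp_all add: quantifiers)
  show "(\<^bold>\<forall>\<^bsub>?E\<^esub> f) \<rightharpoonup>\<^bsub>?E\<^esub> (\<^bold>\<exists>\<^bsub>?E\<^esub> f) = \<one>\<^bsub>?E\<^esub>"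
    using f_closed by (simp add: quantifiers restrict_eq_iff[where B = "carrier A"]
        necessity_le_possibility[OF normal] imp_eq_one_iff)
  show "(\<^bold>\<exists>\<^bsub>?E\<^esub> f) \<rightharpoonup>\<^bsub>?E\<^esub> (\<^bold>\<forall>\<^bsub>?E\<^esub> (\<^bold>\<exists>\<^bsub>?E\<^esub> f)) = \<one>\<^bsub>?E\<^esub>"
    using f_closed by (simp add: quantifiers restrict_eq_iff[where B = "carrier A"]
        le_necessity_const imp_eq_one_iff cong: necessity_cong)
  fix g assume "g \<in> carrier ?E"
  then have g_closed: "g \<in> W \<rightarrow> carrier A"
    by auto
  show "\<^bold>\<forall>\<^bsub>?E\<^esub> (f \<rightharpoonup>\<^bsub>?E\<^esub> (\<^bold>\<forall>\<^bsub>?E\<^esub> g)) = (\<^bold>\<exists>\<^bsub>?E\<^esub> f) \<rightharpoonup>\<^bsub>?E\<^esub> (\<^bold>\<forall>\<^bsub>?E\<^esub> g)"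
    using f_closed g_closed
    by (simp add: quantifiers necessity_imp_const cong: restrict_cong necessity_cong)
  show "\<^bold>\<forall>\<^bsub>?E\<^esub> ((\<^bold>\<forall>\<^bsub>?E\<^esub> f) \<rightharpoonup>\<^bsub>?E\<^esub> g) = (\<^bold>\<forall>\<^bsub>?E\<^esub> f) \<rightharpoonup>\<^bsub>?E\<^esub> (\<^bold>\<forall>\<^bsub>?E\<^esub> g)"
    using f_closed g_closed
    by (simp add: quantifiers necessity_const_imp cong: restrict_cong necessity_cong)
  show "\<^bold>\<forall>\<^bsub>?E\<^esub> (f \<curlywedge>\<^bsub>?E\<^esub> g) = (\<^bold>\<forall>\<^bsub>?E\<^esub> f) \<curlywedge>\<^bsub>?E\<^esub> (\<^bold>\<forall>\<^bsub>?E\<^esub> g)"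
    using f_closed g_closed
    by (simp add: quantifiers necessity_meet cong: restrict_cong necessity_cong)
  show "\<^bold>\<exists>\<^bsub>?E\<^esub> (f \<curlyvee>\<^bsub>?E\<^esub> g) = (\<^bold>\<exists>\<^bsub>?E\<^esub> f) \<curlyvee>\<^bsub>?E\<^esub> (\<^bold>\<exists>\<^bsub>?E\<^esub> g)"
    using f_closed g_closed
    by (simp add: quantifiers possibility_join cong: restrict_cong possibility_cong)
  show "\<^bold>\<exists>\<^bsub>?E\<^esub> (f \<otimes>\<^bsub>?E\<^esub> (\<^bold>\<exists>\<^bsub>?E\<^esub> g)) = (\<^bold>\<exists>\<^bsub>?E\<^esub> f) \<otimes>\<^bsub>?E\<^esub> (\<^bold>\<exists>\<^bsub>?E\<^esub> g)"
    using f_closed g_closed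
    by (simp add: quantifiers possibility_mult_const cong: restrict_cong possibility_cong)
next
  show "\<^bold>\<forall>\<^bsub>?E\<^esub> \<one>\<^bsub>?E\<^esub> = \<one>\<^bsub>?E\<^esub>"
    by (simp add: all_complex_algebra_eq_one_iff le_one)
  show "\<^bold>\<exists>\<^bsub>?E\<^esub> \<zero>\<^bsub>?E\<^esub> = \<zero>\<^bsub>?E\<^esub>"
    by (simp add: ex_complex_algebra possibility_zero cong: possibility_cong)
qed

lemma focal_element_complex_algebra: "focal_element (complex_algebra A W \<pi>) \<pi>"
proof -
  let ?E = "complex_algebra A W \<pi>"
  have "{f \<in> carrier ?E. \<^bold>\<forall>\<^bsub>?E\<^esub> f = \<one>\<^bsub>?E\<^esub>} = {f \<in> W \<rightarrow>\<^sub>E carrier A. \<forall>w\<in>W. \<pi> w \<preceq> f w}"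
    by (auto simp: all_complex_algebra_eq_one_iff)
  then show ?thesis
    using distribution
    by (auto simp: focal_element_def least_def bl_order_def complex_algebra_le_iff)
qed

end

theorem theorem9:
  fixes A :: "('a, 'm) bl_scheme" and W :: "'w set" and \<pi> :: "'w \<Rightarrow> 'a"
  assumes "complete_bl_algebra A"
    and "possibilistic_frame A W \<pi>"
  shows "epistemic_bl_algebra (complex_algebra A W \<pi>)
    \<and> focal_element (complex_algebra A W \<pi>) \<pi>
    \<and> c_ebl_algebra (complex_algebra A W \<pi>)"
proof (intro conjI)
  interpret complete_bl_algebra A
    by fact
  interpret possibility_distribution A W \<pi>
    using assms(2) by unfold_locales (simp add: possibilistic_frame_def)
  show epistemic: "epistemic_bl_algebra (complex_algebra A W \<pi>)"
    using assms(2)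
    by (intro epistemic_bl_algebra_complex_algebra) (simp add: possibilistic_frame_def)
  show focal: "focal_element (complex_algebra A W \<pi>) \<pi>"
    by (fact focal_element_complex_algebra)
  show "c_ebl_algebra (complex_algebra A W \<pi>)"
    using epistemic focal by (auto intro: c_ebl_algebra.intro c_ebl_algebra_axioms.intro)
qed

end
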